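(* Let $d\ge 1$ be an integer, let $p\in[0,1]$, and let $\mathcal{E}(\sigma)=(1-p)\,\sigma+\frac{p}{d}I_d$ be the depolarizing channel with factor $p$ on a $d$-dimensional quantum system. For every pure quantum state $\rho$ (a $d\times d$ density matrix) and every positive integer $n$, the fidelity between $\rho$ and the state $\mathcal{E}^n(\rho)$ obtained after $n$ depolarizing channels is $$F\big(\rho,\mathcal{E}^n(\rho)\big)=(1-p)^n+\frac{1-(1-p)^n}{d}.$$
   Context: States are described by density matrices (positive semidefinite matrices of trace $1$) on $\mathbb{C}^d$. A state is pure if it is a rank-one projector. $I_d$ is the $d\times d$ identity matrix. $\mathcal{E}^n$ denotes the $n$-fold composition of $\mathcal{E}$ with itself. The fidelity of two density matrices $\rho,\sigma$ is $F(\rho,\sigma)=\big(\mathrm{tr}\sqrt{\sqrt{\rho}\,\sigma\sqrt{\rho}}\big)^2$; if at least one of them is pure, it equals $\mathrm{tr}(\rho\sigma)$. *)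

theory Defs
  imports "HOL-Analysis.Analysis"
begin

(* Matrices on C^d are elements of complex^'n^'n with d = CARD('n). The matrix product is **;
   the type-class operations * and ^ on vectors act componentwise and are not used on matrices. *)

definition conj_transpose :: "complex^'n^'m \<Rightarrow> complex^'m^'n" where
  "conj_transpose A = (\<chi> i j. cnj (A $ j $ i))"

definition hermitian :: "complex^'n^'n \<Rightarrow> bool" where
  "hermitian A \<longleftrightarrow> conj_transpose A = A"

(* For Hermitian A the quadratic form is real, so taking its real part loses nothing. *)
definition pos_semidef :: "complex^'n^'n \<Rightarrow> bool" where
  "pos_semidef A \<longleftrightarrow>
     hermitian A \<and> (\<forall>x :: complex^'n. 0 \<le> Re (\<Sum>i\<in>UNIV. cnj (x $ i) * (A *v x) $ i))"

definition density_matrix :: "complex^'n^'n \<Rightarrow> bool" where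
  "density_matrix \<rho> \<longleftrightarrow> pos_semidef \<rho> \<and> trace \<rho> = 1"

definition projector :: "complex^'n^'n \<Rightarrow> bool" where
  "projector P \<longleftrightarrow> hermitian P \<and> P ** P = P"

definition pure_state :: "complex^'n^'n \<Rightarrow> bool" where
  "pure_state \<rho> \<longleftrightarrow> density_matrix \<rho> \<and> projector \<rho> \<and> rank \<rho> = 1"

(* The unique positive semidefinite square root; only meaningful for positive semidefinite A. *)
definition psd_sqrt :: "complex^'n^'n \<Rightarrow> complex^'n^'n" where
  "psd_sqrt A = (THE B. pos_semidef B \<and> B ** B = A)"

(* Complex-valued, because trace is; it is a nonnegative real on density matrices. *)
definition fidelity :: "complex^'n^'n \<Rightarrow> complex^'n^'n \<Rightarrow> complex" where
  "fidelity \<rho> \<sigma> = (trace (psd_sqrt (psd_sqrt \<rho> ** \<sigma> ** psd_sqrt \<rho>)))\<^sup>2"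

definition depolarizing :: "real \<Rightarrow> complex^'n^'n \<Rightarrow> complex^'n^'n" where
  "depolarizing p \<sigma> = (1 - p) *\<^sub>R \<sigma> + (p / real CARD('n)) *\<^sub>R mat 1"

end

theory Submission
  imports Defs
begin

text \<open>
  Iterating the channel gives \<open>\<E>\<^sup>n(\<rho>) = q \<rho> + ((1 - q) / d) I\<close> with \<open>q = (1 - p)\<^sup>n\<close>. A pure state is its
  own square root, so the matrix under the outer root is \<open>\<rho> \<E>\<^sup>n(\<rho>) \<rho> = c \<rho>\<close> with \<open>c = q + (1 - q) / d\<close>;
  its root is \<open>\<surd>c \<rho>\<close>, whose trace squares to \<open>c\<close>. What needs an argument is that \<open>\<surd>c P\<close> is the only
  positive semidefinite root of \<open>c P\<close> for a projector \<open>P\<close>. If \<open>B\<close> is another one and \<open>c > 0\<close>, then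
  \<open>(B (I - P))\<^sup>* (B (I - P)) = 0\<close>, so \<open>B = B P = P B\<close> and
  \<open>(B + \<surd>c P) (B - \<surd>c P) = 0\<close>; hence the quadratic form of \<open>P\<close> vanishes on the range of
  \<open>B - \<surd>c P\<close>, which lies in the range of \<open>P\<close>.
\<close>

text \<open>Conjugate-linear in the first argument, to match the quadratic form in
  \<open>pos_semidef\<close>.\<close>

definition cinner :: "complex^'n \<Rightarrow> complex^'n \<Rightarrow> complex" where
  "cinner x y = (\<Sum>i\<in>UNIV. cnj (x $ i) * y $ i)"

lemma cinner_self: "cinner x x = complex_of_real ((norm x)\<^sup>2)"
  unfolding cinner_def norm_vec_def L2_set_def
  by (simp add: sum_nonneg mult.commute complex_norm_square[symmetric])

lemma cinner_add_right: "cinner x (y + z) = cinner x y + cinner x z"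
  by (simp add: cinner_def algebra_simps sum.distrib)

lemma cinner_scaleR_right: "cinner x (c *\<^sub>R y) = c *\<^sub>R cinner x y"
  by (simp add: cinner_def scaleR_sum_right)

lemma cinner_zero_right [simp]: "cinner x 0 = 0"
  by (simp add: cinner_def)

lemma cinner_adjoint: "cinner x (A *v y) = cinner (conj_transpose A *v x) y"
  unfolding cinner_def matrix_vector_mult_def conj_transpose_def
  by (simp add: sum_distrib_left sum_distrib_right, subst sum.swap) (simp add: ac_simps)

lemma pos_semidef_cinner:
  "pos_semidef A \<longleftrightarrow> hermitian A \<and> (\<forall>x. 0 \<le> Re (cinner x (A *v x)))"
  by (simp add: pos_semidef_def cinner_def)

lemma scaleR_matrix_vector_mult: "(c *\<^sub>R A) *v x = c *\<^sub>R (A *v (x :: 'a::real_algebra_1^'n))"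
  by (simp add: matrix_vector_mult_def vec_eq_iff scaleR_sum_right)

lemma matrix_mult_add_left: "(A + B) ** C = A ** C + B ** (C :: 'a::semiring_1^'k^'n)"
  by (simp add: matrix_matrix_mult_def vec_eq_iff sum.distrib distrib_right)

lemma matrix_mult_diff_left: "(A - B) ** C = A ** C - B ** (C :: 'a::ring_1^'k^'n)"
  by (simp add: matrix_matrix_mult_def vec_eq_iff sum_subtractf left_diff_distrib)

lemma matrix_mult_diff_right: "A ** (B - C) = A ** B - A ** (C :: 'a::ring_1^'k^'n)"
  by (simp add: matrix_matrix_mult_def vec_eq_iff sum_subtractf right_diff_distrib)

lemma trace_scaleR: "trace (c *\<^sub>R (A :: 'a::real_algebra_1^'n^'n)) = c *\<^sub>R trace A"
  by (simp add: trace_def scaleR_sum_right)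

lemma conj_transpose_mult:
  "conj_transpose (A ** B) = conj_transpose B ** conj_transpose A"
  by (simp add: conj_transpose_def matrix_matrix_mult_def vec_eq_iff mult.commute)

lemma conj_transpose_diff: "conj_transpose (A - B) = conj_transpose A - conj_transpose B"
  by (simp add: conj_transpose_def vec_eq_iff)

lemma conj_transpose_scaleR: "conj_transpose (c *\<^sub>R A) = c *\<^sub>R conj_transpose A"
  by (simp add: conj_transpose_def vec_eq_iff)

lemma conj_transpose_mat_1 [simp]: "conj_transpose (mat 1) = mat 1"
  by (auto simp: conj_transpose_def mat_def vec_eq_iff)

text \<open>Moving \<open>A\<close> across the inner product turns the squared norm of
  \<open>A *v x\<close> into a form in \<open>conj_transpose A ** A\<close>.\<close>

lemma conj_transpose_mult_self_eq_0D:
  assumes "conj_transpose A ** A = 0"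
  shows "A = 0"
proof -
  have "A *v x = 0" for x
  proof -
    have "cinner (A *v x) (A *v x) = cinner ((conj_transpose A ** A) *v x) x"
      by (metis cinner_adjoint conj_transpose_mult matrix_vector_mul_assoc)
    also have "\<dots> = 0"
      using assms by (simp add: cinner_def)
    finally show ?thesis
      by (simp add: cinner_self)
  qed
  then show ?thesis
    by (simp add: matrix_eq)
qed

text \<open>\<open>P\<close> equals \<open>conj_transpose P ** P\<close>, so one factor can be moved
  to the left argument.\<close>

lemma cinner_projector:
  assumes "projector P"
  shows "cinner x (P *v x) = complex_of_real ((norm (P *v x))\<^sup>2)"
  by (metis assms cinner_adjoint cinner_self hermitian_def matrix_vector_mul_assoc projector_def)

lemma pos_semidef_scaleR_projector:
  assumes "projector P" "0 \<le> c"
  shows "pos_semidef (c *\<^sub>R P)"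
  using assms
  by (simp add: pos_semidef_cinner hermitian_def projector_def conj_transpose_scaleR
      scaleR_matrix_vector_mult cinner_scaleR_right cinner_projector)

lemma psd_root_projector_unique:
  assumes P: "projector P" and B: "pos_semidef B" and c: "0 \<le> c"
    and BB: "B ** B = c *\<^sub>R P"
  shows "B = sqrt c *\<^sub>R P"
proof (cases "c = 0")
  case True
  \<comment> \<open>As \<open>B\<close> is Hermitian, \<open>B ** B = 0\<close> is an instance of
    \<open>conj_transpose B ** B = 0\<close>.\<close>
  then show ?thesis
    using B BB conj_transpose_mult_self_eq_0D[of B] by (simp add: pos_semidef_def hermitian_def)
next
  case False
  define s where "s = sqrt c"
  have s: "s > 0" "s * s = c"
    using c False by (auto simp: s_def)
  have hB: "conj_transpose B = B" and hP: "conj_transpose P = P" and PP: "P ** P = P"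
    using B P by (auto simp: pos_semidef_def projector_def hermitian_def)
  have "conj_transpose (B ** (mat 1 - P)) ** (B ** (mat 1 - P))
      = (mat 1 - P) ** (B ** B) ** (mat 1 - P)"
    by (simp add: conj_transpose_mult conj_transpose_diff hB hP matrix_mul_assoc)
  also have "\<dots> = 0"
    by (simp add: BB matrix_scalar_ac scalar_matrix_assoc[symmetric] matrix_mult_diff_left
        matrix_mult_diff_right PP)
  finally have "B ** (mat 1 - P) = 0"
    by (rule conj_transpose_mult_self_eq_0D)
  then have BP: "B ** P = B"
    by (simp add: matrix_mult_diff_right)
  \<comment> \<open>Take adjoints of \<open>B ** P = B\<close>; both factors are Hermitian.\<close>
  then have PB: "P ** B = B"
    by (metis conj_transpose_mult hB hP)
  define D where "D = B - s *\<^sub>R P"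
  have PD: "P ** D = D"
    by (simp add: D_def matrix_mult_diff_right PB PP matrix_scalar_ac scalar_matrix_assoc[symmetric])
  \<comment> \<open>With \<open>s * s = c\<close>, both \<open>B ** D\<close> and
    \<open>- s *\<^sub>R D\<close> equal \<open>c *\<^sub>R P - s *\<^sub>R B\<close>.\<close>
  have "B ** D + s *\<^sub>R (P ** D) = 0"
    unfolding PD
    by (simp add: D_def matrix_mult_diff_right matrix_scalar_ac scalar_matrix_assoc[symmetric] BB BP s
        scaleR_diff_right)
  then have z: "B *v (D *v x) + s *\<^sub>R (P *v (D *v x)) = 0" for x
    by (metis matrix_vector_mul_assoc matrix_vector_mult_add_rdistrib matrix_vector_mult_0
        scaleR_matrix_vector_mult)
  have "D *v x = 0" for x
  proof -
    define y where "y = D *v x"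
    have "cinner y (B *v y) + s *\<^sub>R cinner y (P *v y) = 0"
      using z[of x] by (metis cinner_add_right cinner_scaleR_right cinner_zero_right y_def)
    then have "Re (cinner y (B *v y)) + s * (norm (P *v y))\<^sup>2 = 0"
      by (simp add: cinner_projector[OF P] complex_eq_iff)
    \<comment> \<open>Positivity of \<open>B\<close> excludes the other Hermitian root
      \<open>- s *\<^sub>R P\<close>: two nonnegative terms with sum 0 both vanish.\<close>
    moreover have "0 \<le> Re (cinner y (B *v y))"
      using B by (simp add: pos_semidef_cinner)
    ultimately have "s * (norm (P *v y))\<^sup>2 \<le> 0"
      by linarith
    then have "P *v y = 0"
      using s by (simp add: mult_le_0_iff)
    then show ?thesis
      by (simp add: y_def matrix_vector_mul_assoc PD)
  qed
  then have "D = 0"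
    by (simp add: matrix_eq)
  then show ?thesis
    by (simp add: D_def s_def)
qed

text \<open>Evaluates both roots in the fidelity: the inner one with factor 1, the outer one with
  the claimed value as factor.\<close>

lemma psd_sqrt_scaleR_projector:
  assumes "projector P" "0 \<le> c"
  shows "psd_sqrt (c *\<^sub>R P) = sqrt c *\<^sub>R P"
  unfolding psd_sqrt_def
proof (rule the_equality)
  show "pos_semidef (sqrt c *\<^sub>R P) \<and> sqrt c *\<^sub>R P ** sqrt c *\<^sub>R P = c *\<^sub>R P"
    using assms pos_semidef_scaleR_projector[of P "sqrt c"]
    by (simp add: matrix_scalar_ac scalar_matrix_assoc[symmetric] projector_def)
qed (use assms psd_root_projector_unique in blast)

lemma depolarizing_funpow:
  fixes \<rho> :: "complex^'n^'n"
  shows "(depolarizing p ^^ n) \<rho>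
    = (1 - p) ^ n *\<^sub>R \<rho> + ((1 - (1 - p) ^ n) / real CARD('n)) *\<^sub>R mat 1"
proof (induction n)
  case (Suc n)
  define r where "r = (1 - (1 - p) ^ n) / real CARD('n)"
  \<comment> \<open>The identity coefficient starts at 0 and follows an affine recursion that fixes
    \<open>1 / d\<close>.\<close>
  have r: "(1 - p) * r + p / real CARD('n) = (1 - (1 - p) ^ Suc n) / real CARD('n)"
    by (simp add: r_def field_simps)
  have "(depolarizing p ^^ Suc n) \<rho> = depolarizing p ((1 - p) ^ n *\<^sub>R \<rho> + r *\<^sub>R mat 1)"
    using Suc by (simp add: r_def)
  also have "\<dots> = (1 - p) ^ Suc n *\<^sub>R \<rho> + ((1 - p) * r + p / real CARD('n)) *\<^sub>R mat 1"
    by (simp add: depolarizing_def scaleR_add_right scaleR_add_left)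
  finally show ?case
    unfolding r .
qed simp

theorem theorem2:
  fixes \<rho> :: "complex^'n^'n" and p :: real and n :: nat
  assumes "0 \<le> p" and "p \<le> 1"
    and "pure_state \<rho>"
    and "n \<ge> 1"
  shows "fidelity \<rho> ((depolarizing p ^^ n) \<rho>)
    = complex_of_real ((1 - p) ^ n + (1 - (1 - p) ^ n) / real CARD('n))"
proof -
  define c where "c = (1 - p) ^ n + (1 - (1 - p) ^ n) / real CARD('n)"
  have P: "projector \<rho>" and tr: "trace \<rho> = 1"
    using assms by (auto simp: pure_state_def density_matrix_def)
  then have PP: "\<rho> ** \<rho> = \<rho>"
    by (simp add: projector_def)
  \<comment> \<open>Since \<open>p\<close> lies in [0,1], so does \<open>(1 - p) ^ n\<close>, and
    both terms of \<open>c\<close> are nonnegative.\<close>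
  have c: "0 \<le> c"
    using assms by (simp add: c_def power_le_one)
  have root: "psd_sqrt \<rho> = \<rho>"
    using psd_sqrt_scaleR_projector[OF P, of 1] by simp
  have "\<rho> ** (depolarizing p ^^ n) \<rho> ** \<rho> = c *\<^sub>R \<rho>"
    by (simp add: depolarizing_funpow matrix_add_ldistrib matrix_mult_add_left PP c_def
         matrix_scalar_ac scalar_matrix_assoc[symmetric] scaleR_add_left)
  then have "fidelity \<rho> ((depolarizing p ^^ n) \<rho>) = (complex_of_real (sqrt c))\<^sup>2"
    by (simp add: fidelity_def root psd_sqrt_scaleR_projector[OF P c] trace_scaleR tr
        flip: of_real_def)
  also have "\<dots> = complex_of_real c"
    using c by (simp flip: of_real_power)
  finally show ?thesis
    by (simp add: c_def)
qed

end
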